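(* Let $\lambda>0$, $m\in\{0,1,2,\ldots\}$, and for each $\kappa>0$ let $Z_\kappa$ have the Gamma distribution with parameter $\kappa$. Then for all $F\in\mathcal{C}_c^\infty$, $$E\,L_\lambda^m(Z_\lambda)F(Z_\lambda)=\lambda(\lambda+1)\cdots(\lambda+m-1)\,E\,F^{(m)}(Z_{\lambda+m}),$$ and hence $(Z_\lambda)_\lambda^{(m)}=Z_{\lambda+m}$ in distribution; that is, the $m$-th order transformation induced by the Laguerre polynomial $L_\lambda^m$ maps the Gamma distribution with parameter $\lambda$ to the Gamma distribution with parameter $\lambda+m$.
   Context: The Gamma distribution with parameter $\kappa$ has density $x^{\kappa-1}e^{-x}/\Gamma(\kappa)$, $x>0$. The (monic) Laguerre polynomials are defined by $$(1+t)^{-\lambda}\exp\left\{\frac{xt}{1+t}\right\}=\sum_{m=0}^\infty L_\lambda^m(x)\frac{t^m}{m!},\quad\text{equivalently}\quad L_\lambda^m(x)=(-1)^mx^{-\lambda+1}e^x\frac{d^m}{dx^m}\left(x^{\lambda+m-1}e^{-x}\right).$$ $\mathcal{C}_c^\infty$ is the set of infinitely differentiable compactly supported functions on $\mathbf{R}$. For $X$ whose moments up to order $2m$ agree with those of $Z_\lambda$, $X_\lambda^{(m)}$ denotes a variable with the $X$-$L_\lambda^m$ biased distribution, the unique distribution characterized by $E\,L_\lambda^m(X)F(X)=\alpha\,E\,F^{(m)}(X_\lambda^{(m)})$ with $\alpha=\frac1{m!}E[X^mL_\lambda^m(X)]$; it is determined by this equality for all $F\in\mathcal{C}_c^\infty$.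 The empty product is $1$. *)

theory Defs
  imports "HOL-Probability.Probability"
begin

definition gamma_density :: "real \<Rightarrow> real \<Rightarrow> real" where
  "gamma_density \<kappa> x = (if x > 0 then x powr (\<kappa> - 1) * exp (- x) / Gamma \<kappa> else 0)"

definition gamma_distribution :: "real \<Rightarrow> real measure" where
  "gamma_distribution \<kappa> = density lborel (\<lambda>x. ennreal (gamma_density \<kappa> x))"

(* (1 + t) ^ (-lam) * exp (x t / (1 + t)), as a formal power series in t *)
definition laguerre_gf :: "real \<Rightarrow> real \<Rightarrow> real fps" where
  "laguerre_gf lam x = fps_binomial (- lam) * fps_compose (fps_exp x) (fps_X / (1 + fps_X))"

(* The monic normalisation: the generating function is the sum of laguerre lam m x * t ^ m / m!.
   This differs from the classical Laguerre polynomials by scaling and by a shift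
   of the parameter: laguerre lam 1 x = x - lam. *)
definition laguerre :: "real \<Rightarrow> nat \<Rightarrow> real \<Rightarrow> real" where
  "laguerre lam m x = fact m * fps_nth (laguerre_gf lam x) m"

definition test_functions :: "(real \<Rightarrow> real) set" where
  "test_functions =
     {F. (\<forall>k x. (deriv ^^ k) F differentiable (at x)) \<and> compact (closure {x. F x \<noteq> 0})}"

definition moments_agree :: "nat \<Rightarrow> 'a measure \<Rightarrow> ('a \<Rightarrow> real) \<Rightarrow> 'b measure \<Rightarrow> ('b \<Rightarrow> real) \<Rightarrow> bool" where
  "moments_agree n M X N Y \<longleftrightarrow>
     (\<forall>k\<le>n. integrable M (\<lambda>\<omega>. X \<omega> ^ k) \<and> integrable N (\<lambda>\<omega>. Y \<omega> ^ k) \<and>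
            (\<integral>\<omega>. X \<omega> ^ k \<partial>M) = (\<integral>\<omega>. Y \<omega> ^ k \<partial>N))"

(* \<nu> is an X-P biased distribution of order m: E P(X) F(X) = \<alpha> E F^(m)(Y) for Y with law \<nu>,
   where \<alpha> = E X^m P(X) / m! *)
definition biased_distribution ::
    "(real \<Rightarrow> real) \<Rightarrow> nat \<Rightarrow> 'a measure \<Rightarrow> ('a \<Rightarrow> real) \<Rightarrow> real measure \<Rightarrow> bool" where
  "biased_distribution P m M X \<nu> \<longleftrightarrow>
     prob_space \<nu> \<and> sets \<nu> = sets borel \<and>
     (\<forall>F\<in>test_functions.
        (\<integral>\<omega>. P (X \<omega>) * F (X \<omega>) \<partial>M) =
        (1 / fact m * (\<integral>\<omega>. X \<omega> ^ m * P (X \<omega>) \<partial>M)) * (\<integral>y. (deriv ^^ m) F y \<partial>\<nu>))"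

(* \<nu> is a law of the m-th order Laguerre transform of X; the transform is defined
   only for X whose moments up to order 2 m are those of the Gamma distribution with parameter lam *)
definition laguerre_biased ::
    "real \<Rightarrow> nat \<Rightarrow> 'a measure \<Rightarrow> ('a \<Rightarrow> real) \<Rightarrow> real measure \<Rightarrow> bool" where
  "laguerre_biased lam m M X \<nu> \<longleftrightarrow>
     prob_space M \<and> X \<in> borel_measurable M \<and>
     moments_agree (2 * m) M X (gamma_distribution lam) (\<lambda>x. x) \<and>
     biased_distribution (laguerre lam m) m M X \<nu>"

definition laguerre_transform :: "real \<Rightarrow> nat \<Rightarrow> real measure \<Rightarrow> real measure" where
  "laguerre_transform lam m \<mu> = (THE \<nu>. laguerre_biased lam m \<mu> (\<lambda>x. x) \<nu>)"

end

theory Submission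
  imports Defs "HOL-Real_Asymp.Real_Asymp"
begin

text \<open>
  Write \<open>w\<^sub>\<kappa>(x) = x powr (\<kappa> - 1) * exp (- x)\<close> for the Gamma weight. The Laguerre polynomials
  satisfy \<open>L\<^sub>\<lambda>\<^sup>(\<^sup>m\<^sup>+\<^sup>1\<^sup>) w\<^sub>\<lambda> = - (L\<^sub>\<lambda>\<^sub>+\<^sub>1\<^sup>(\<^sup>m\<^sup>) w\<^sub>\<lambda>\<^sub>+\<^sub>1)'\<close>, one step of the Rodrigues formula, so
  one integration by parts trades a degree of the polynomial for a derivative of the test function
  and raises the parameter by one, at the cost of the factor
  \<open>\<lambda> = Gamma (\<lambda> + 1) / Gamma \<lambda>\<close>. Induction on \<open>m\<close> gives the identity with constant
  \<open>\<lambda>(\<lambda> + 1)\<dots>(\<lambda> + m - 1)\<close> (\<open>laguerre_poly_duality\<close>). The Rodrigues step is taken as the recursive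
  definition of \<open>laguerre_poly\<close>; an explicit formula for its coefficients links it to the
  generating function (\<open>laguerre_eq_poly\<close>).

  The identity is proved for all smooth functions whose derivatives grow polynomially. This class
  contains the test functions and also \<open>x ^ m\<close>, for which the identity evaluates the biasing
  constant \<open>\<alpha> = E X\<^sup>m L(X) / m!\<close> to the same product. Since this product is positive, a law
  \<open>\<nu>\<close> is biased if and only if \<open>\<integral> F\<^sup>(\<^sup>m\<^sup>) d\<nu> = \<integral> F\<^sup>(\<^sup>m\<^sup>) d\<mu>\<close> for all test functions \<open>F\<close>, where
  \<open>\<mu>\<close> is the Gamma distribution with parameter \<open>\<lambda> + m\<close>.

  It remains to see that these integrals determine \<open>\<nu>\<close> (\<open>measure_eqI_higher_deriv_test_functions\<close>).
  Not every test function is an \<open>m\<close>-th derivative of one, but \<open>F(x) - F(x - h)\<close> always is the first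
  derivative of a test function, and the contribution of the shifted term vanishes as \<open>h\<close> tends to
  infinity because a probability measure is tight. Hence one derivative at a time can be removed.
  Finally, indicators of half-lines are bounded limits of test functions built from
  \<open>exp (- 1 / x)\<close>, so integrals of test functions determine a probability measure.
\<close>

section \<open>Laguerre polynomials by recursion\<close>

text \<open>
  The recursion is \<open>L\<^sub>\<lambda>\<^sup>(\<^sup>m\<^sup>+\<^sup>1\<^sup>) = (x - \<lambda>) P - x P'\<close> with \<open>P = L\<^sub>\<lambda>\<^sub>+\<^sub>1\<^sup>(\<^sup>m\<^sup>)\<close>, which is
  \<open>- (P w\<^sub>\<lambda>\<^sub>+\<^sub>1)' / w\<^sub>\<lambda>\<close>: the form in which integration by parts will meet it.
\<close>

fun laguerre_poly :: "real \<Rightarrow> nat \<Rightarrow> real poly" where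
  "laguerre_poly lam 0 = 1"
| "laguerre_poly lam (Suc m) =
     (let P = laguerre_poly (lam + 1) m in pCons 0 (P - pderiv P) - smult lam P)"

text \<open>
  Both cases of the induction step are instances of the absorption identity
  \<open>k * (a choose k) = a * ((a - 1) choose (k - 1))\<close>, with \<open>a = - \<lambda> - i\<close>.
\<close>

lemma coeff_laguerre_poly:
  "coeff (laguerre_poly lam m) i =
     (if i \<le> m then fact m / fact i * ((- lam - real i) gchoose (m - i)) else 0)"
proof (induction m arbitrary: lam i)
  case 0
  then show ?case by (cases i) auto
next
  case (Suc m)
  define P where "P = laguerre_poly (lam + 1) m"
  have IH: "coeff P i = (if i \<le> m then fact m / fact i * ((- (lam + 1) - real i) gchoose (m - i)) else 0)" for i
    using Suc.IH[of "lam + 1" i] by (simp add: P_def)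
  have rec: "laguerre_poly lam (Suc m) = pCons 0 (P - pderiv P) - smult lam P"
    by (simp add: P_def Let_def)
  show ?case
  proof (cases i)
    case 0
    have "real (Suc m) * (- lam gchoose Suc m) = - lam * (- lam - 1 gchoose m)"
      by (rule gbinomial_absorption)
    then have "fact m * (real (Suc m) * (- lam gchoose Suc m)) = fact m * (- lam * (- lam - 1 gchoose m))"
      by simp
    moreover have "coeff P 0 = fact m * (- lam - 1 gchoose m)"
      by (simp add: IH minus_diff_commute)
    ultimately show ?thesis
      using 0 unfolding rec by (simp add: algebra_simps)
  next
    case [simp]: (Suc j)
    define a where "a = - lam - 1 - real j"
    have frac: "u / v * g + a * (u / (s * v) * g') = u / (s * v) * (s * g + a * g')"
      if "s \<noteq> 0" "v \<noteq> 0" for s v u g g' :: real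
      using that by (simp add: field_simps)
    have lhs: "coeff (laguerre_poly lam (Suc m)) i = coeff P j + a * coeff P (Suc j)"
      unfolding rec by (simp add: coeff_pderiv a_def algebra_simps)
    consider "j < m" | "j = m" | "j > m" by linarith
    then show ?thesis
    proof cases
      case 1
      then obtain k where k: "m - j = Suc k" by (metis Suc_diff_Suc)
      then have m: "real m = real j + real k + 1" and k': "m - Suc j = k" using 1 by linarith+
      have "coeff P j = fact m / fact j * (a gchoose Suc k)"
        using 1 k by (simp add: IH a_def)
      moreover have "coeff P (Suc j) = fact m / fact (Suc j) * ((a - 1) gchoose k)"
        using 1 k' by (simp add: IH a_def algebra_simps)
      ultimately have "coeff P j + a * coeff P (Suc j) =
          fact m / fact (Suc j) * (real (Suc j) * (a gchoose Suc k) + a * ((a - 1) gchoose k))"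
        using frac[of "real (Suc j)" "fact j" "fact m" "a gchoose Suc k" "(a - 1) gchoose k"]
        by (simp add: fact_Suc del: of_nat_Suc)
      also have "\<dots> = fact m / fact (Suc j) * (real (Suc m) * (a gchoose Suc k))"
        by (simp add: gbinomial_absorption [symmetric] m algebra_simps)
      also have "\<dots> = fact (Suc m) / fact (Suc j) * (a gchoose Suc k)"
        by simp
      finally show ?thesis
        unfolding lhs using 1 k by (simp add: a_def algebra_simps)
    next
      case 2
      then show ?thesis unfolding lhs by (simp add: IH)
    next
      case 3
      then show ?thesis unfolding lhs by (simp add: IH)
    qed
  qed
qed

lemma poly_laguerre_poly:
  "poly (laguerre_poly lam m) x =
     (\<Sum>i\<le>m. fact m / fact i * ((- lam - real i) gchoose (m - i)) * x ^ i)"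
proof -
  have "degree (laguerre_poly lam m) \<le> m"
    by (intro degree_le) (simp add: coeff_laguerre_poly)
  then have "poly (laguerre_poly lam m) x = (\<Sum>i\<le>m. coeff (laguerre_poly lam m) i * x ^ i)"
    unfolding poly_altdef by (intro sum.mono_neutral_left) (auto simp: coeff_eq_0)
  then show ?thesis by (simp add: coeff_laguerre_poly)
qed

lemma fps_binomial_mult_fps_X_div_power:
  "fps_binomial a * (fps_X / (1 + fps_X)) ^ i = fps_X ^ i * fps_binomial (a - real i)"
proof -
  have "fps_X / (1 + fps_X) = fps_X * (fps_binomial (-1) :: real fps)"
    by (simp add: fps_binomial_minus_one fps_divide_unit)
  then have "(fps_X / (1 + fps_X)) ^ i = fps_X ^ i * (fps_binomial (- real i) :: real fps)"
    by (simp add: power_mult_distrib fps_binomial_power)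
  then show ?thesis
    using fps_binomial_add_mult[of a "- real i"] by (simp add: mult_ac)
qed

text \<open>
  Expanding the exponential, the generating function is a sum over \<open>i\<close> of
  \<open>x\<^sup>i / i!\<close> times \<open>(1 + t) powr (- \<lambda>) * (t / (1 + t))\<^sup>i = t\<^sup>i * (1 + t) powr (- \<lambda> - i)\<close>, and the
  coefficients of the latter are again generalised binomials.
\<close>

lemma laguerre_eq_poly: "laguerre lam m x = poly (laguerre_poly lam m) x"
proof -
  define b :: "real fps" where "b = fps_X / (1 + fps_X)"
  have b0: "fps_nth b 0 = 0"
    by (simp add: b_def fps_divide_unit)
  have comp: "fps_nth (fps_compose (fps_exp x) b) k = (\<Sum>i\<le>m. x ^ i / fact i * fps_nth (b ^ i) k)" if "k \<le> m" for k
    unfolding fps_compose_nth using that b0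
    by (intro sum.mono_neutral_cong_left) (auto simp: startsby_zero_power_prefix)
  have "fps_nth (laguerre_gf lam x) m =
      (\<Sum>j=0..m. fps_nth (fps_binomial (- lam)) j * (\<Sum>i\<le>m. x ^ i / fact i * fps_nth (b ^ i) (m - j)))"
    unfolding laguerre_gf_def b_def[symmetric] fps_mult_nth by (simp add: comp)
  also have "\<dots> = (\<Sum>i\<le>m. x ^ i / fact i * fps_nth (fps_binomial (- lam) * b ^ i) m)"
    unfolding fps_mult_nth sum_distrib_left by (subst sum.swap) (simp add: mult_ac)
  also have "\<dots> = (\<Sum>i\<le>m. x ^ i / fact i * ((- lam - real i) gchoose (m - i)))"
    unfolding b_def fps_binomial_mult_fps_X_div_power
    by (intro sum.cong) (auto simp: fps_X_power_mult_nth)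
  finally show ?thesis
    unfolding laguerre_def poly_laguerre_poly by (simp add: sum_distrib_left mult_ac)
qed

section \<open>Smooth functions on the line\<close>

definition smooth :: "(real \<Rightarrow> real) \<Rightarrow> bool" where
  "smooth f \<longleftrightarrow> (\<forall>k x. (deriv ^^ k) f differentiable (at x))"

text \<open>
  The smooth functions are the greatest class of differentiable functions closed under
  differentiation, so it suffices to
  exhibit some such class containing the given function. This avoids formulas for higher derivatives.
\<close>

lemma smooth_coinduct:
  assumes "f \<in> S" "\<And>f. f \<in> S \<Longrightarrow> \<exists>f'\<in>S. \<forall>x. (f has_real_derivative f' x) (at x)"
  shows "smooth f"
proof -
  have D: "deriv f \<in> S \<and> (\<forall>x. f differentiable (at x))" if f: "f \<in> S" for f
  proof -
    obtain f' where f': "f' \<in> S" "\<forall>x. (f has_real_derivative f' x) (at x)"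
      using assms(2)[OF f] by blast
    then have "deriv f = f'" by (auto intro!: DERIV_imp_deriv)
    with f' show ?thesis by (auto simp: real_differentiable_def)
  qed
  have "(deriv ^^ k) f \<in> S" for k
    by (induction k) (use assms(1) D in auto)
  with D show ?thesis unfolding smooth_def by blast
qed

lemma smooth_has_derivative: "smooth f \<Longrightarrow> (f has_real_derivative deriv f x) (at x)"
  unfolding smooth_def by (metis DERIV_deriv_iff_real_differentiable funpow_0)

lemma smooth_deriv: "smooth f \<Longrightarrow> smooth (deriv f)"
  unfolding smooth_def by (metis comp_apply funpow_Suc_right)

lemma smooth_higher_deriv: "smooth f \<Longrightarrow> smooth ((deriv ^^ k) f)"
  by (induction k) (auto simp: smooth_deriv)

lemma smooth_continuous_on: "smooth f \<Longrightarrow> continuous_on A f"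
  using smooth_has_derivative by (blast intro: DERIV_continuous_on has_field_derivative_at_within)

lemma smooth_measurable: "smooth f \<Longrightarrow> f \<in> borel_measurable borel"
  by (rule borel_measurable_continuous_onI) (rule smooth_continuous_on)

lemma smooth_antiderivative:
  assumes "smooth f" "\<And>x. (g has_real_derivative f x) (at x)"
  shows "smooth g"
proof (rule smooth_coinduct[where S = "insert g {f. smooth f}"])
  show "\<exists>h'\<in>insert g {f. smooth f}. \<forall>x. (h has_real_derivative h' x) (at x)"
    if "h \<in> insert g {f. smooth f}" for h
    using that assms by (auto intro: smooth_has_derivative smooth_deriv)
qed auto

text \<open>
  A product is smooth because the algebra generated by the smooth functions is closed under
  differentiation; sums have to be included for the product rule.
\<close>

inductive_set smooth_algebra :: "(real \<Rightarrow> real) set" where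
  base: "smooth f \<Longrightarrow> f \<in> smooth_algebra"
| add: "f \<in> smooth_algebra \<Longrightarrow> g \<in> smooth_algebra \<Longrightarrow> (\<lambda>x. f x + g x) \<in> smooth_algebra"
| mult: "f \<in> smooth_algebra \<Longrightarrow> g \<in> smooth_algebra \<Longrightarrow> (\<lambda>x. f x * g x) \<in> smooth_algebra"

lemma smooth_algebra_imp_smooth: "f \<in> smooth_algebra \<Longrightarrow> smooth f"
proof (erule smooth_coinduct)
  show "\<exists>f'\<in>smooth_algebra. \<forall>x. (f has_real_derivative f' x) (at x)"
    if "f \<in> smooth_algebra" for f
    using that
  proof induction
    case (base f)
    then show ?case
      by (blast intro: smooth_has_derivative smooth_deriv smooth_algebra.base)
  next
    case (add f g)
    then obtain f' g' where "f' \<in> smooth_algebra" "\<forall>x. (f has_real_derivative f' x) (at x)"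
      "g' \<in> smooth_algebra" "\<forall>x. (g has_real_derivative g' x) (at x)" by blast
    then show ?case
      by (intro bexI[of _ "\<lambda>x. f' x + g' x"]) (auto intro: smooth_algebra.intros derivative_intros)
  next
    case (mult f g)
    then obtain f' g' where "f' \<in> smooth_algebra" "\<forall>x. (f has_real_derivative f' x) (at x)"
      "g' \<in> smooth_algebra" "\<forall>x. (g has_real_derivative g' x) (at x)" by blast
    with mult.hyps show ?case
      by (intro bexI[of _ "\<lambda>x. f' x * g x + g' x * f x"])
        (auto intro: smooth_algebra.intros DERIV_mult)
  qed
qed

lemma smooth_mult: "smooth f \<Longrightarrow> smooth g \<Longrightarrow> smooth (\<lambda>x. f x * g x)"
  by (blast intro: smooth_algebra_imp_smooth smooth_algebra.intros)

lemma higher_deriv_poly: "(deriv ^^ k) (poly p) = poly ((pderiv ^^ k) p)" for p :: "real poly"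
proof (induction k)
  case (Suc k)
  have "deriv (poly q) = poly (pderiv q)" for q :: "real poly"
    by (intro ext DERIV_imp_deriv poly_DERIV)
  with Suc show ?case by simp
qed simp

lemma smooth_poly: "smooth (poly p)" for p :: "real poly"
  unfolding smooth_def higher_deriv_poly by (auto intro: poly_DERIV simp: real_differentiable_def)

lemma higher_deriv_power: "(deriv ^^ m) (\<lambda>x. x ^ m) = (\<lambda>x::real. fact m)"
proof -
  have "(pderiv ^^ m) (monom c m) = [:fact m * c:]" for c :: real
    by (induction m arbitrary: c) (simp_all add: pderiv_monom funpow_Suc_right monom_0 algebra_simps del: funpow.simps)
  from this[of 1] show ?thesis
    using higher_deriv_poly[of m "monom 1 m"] by (simp add: poly_monom[abs_def] fun_eq_iff)
qed

lemma DERIV_shift_diff: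
  "(f has_real_derivative D) (at (x - h)) \<Longrightarrow> ((\<lambda>x. f (x - h)) has_real_derivative D) (at x)"
  using DERIV_shift[of f D x "- h"] by simp

lemma higher_deriv_diff_shift:
  assumes "smooth f"
  shows "(deriv ^^ k) (\<lambda>x. f x - f (x - h)) = (\<lambda>x. (deriv ^^ k) f x - (deriv ^^ k) f (x - h))"
proof (induction k)
  case (Suc k)
  have "((\<lambda>x. (deriv ^^ k) f x - (deriv ^^ k) f (x - h)) has_real_derivative
      deriv ((deriv ^^ k) f) x - deriv ((deriv ^^ k) f) (x - h)) (at x)" for x
    using smooth_has_derivative[OF smooth_higher_deriv[OF assms, of k]]
    by (intro DERIV_diff DERIV_shift_diff) auto
  then have "deriv (\<lambda>x. (deriv ^^ k) f x - (deriv ^^ k) f (x - h)) =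
      (\<lambda>x. deriv ((deriv ^^ k) f) x - deriv ((deriv ^^ k) f) (x - h))"
    by (intro ext DERIV_imp_deriv)
  with Suc show ?case by simp
qed simp

lemma smooth_diff_shift:
  assumes "smooth f"
  shows "smooth (\<lambda>x. f x - f (x - h))"
  unfolding smooth_def higher_deriv_diff_shift[OF assms]
proof (intro allI)
  fix k x
  note d = smooth_has_derivative[OF smooth_higher_deriv[OF assms, of k]]
  have "((\<lambda>x. (deriv ^^ k) f (x - h)) has_real_derivative deriv ((deriv ^^ k) f) (x - h)) (at x)"
    by (intro DERIV_shift_diff d)
  from DERIV_diff[OF d this] show "(\<lambda>x. (deriv ^^ k) f x - (deriv ^^ k) f (x - h)) differentiable at x"
    by (auto simp: real_differentiable_def)
qed

section \<open>Test functions\<close>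

lemma test_functions_iff:
  "F \<in> test_functions \<longleftrightarrow> smooth F \<and> (\<exists>B. \<forall>x. \<bar>x\<bar> > B \<longrightarrow> F x = 0)"
  unfolding test_functions_def smooth_def mem_Collect_eq compact_closure bounded_iff real_norm_def
  by (rule conj_cong[OF refl]) (metis (mono_tags, lifting) mem_Collect_eq not_le)

lemma higher_deriv_eq_0_outside:
  assumes "\<And>x. \<bar>x\<bar> > B \<Longrightarrow> F x = (0::real)" "\<bar>x\<bar> > B"
  shows "(deriv ^^ k) F x = 0"
  using assms(2)
proof (induction k arbitrary: x)
  case (Suc k)
  have "((deriv ^^ k) F has_real_derivative 0) (at x)"
  proof (rule has_field_derivative_transform_within_open[where S = "{x. \<bar>x\<bar> > B}"])
    show "((\<lambda>x. 0) has_real_derivative 0) (at x)" by simp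
    show "open {x. \<bar>x\<bar> > B}" by (intro open_Collect_less continuous_intros)
  qed (use Suc in auto)
  then show ?case by (simp add: DERIV_imp_deriv)
qed (use assms in auto)

lemma test_function_higher_deriv_bounded:
  assumes "F \<in> test_functions"
  obtains C where "\<And>x. \<bar>(deriv ^^ k) F x\<bar> \<le> C"
proof -
  obtain B where F: "smooth F" "\<And>x. \<bar>x\<bar> > B \<Longrightarrow> F x = 0"
    using assms by (auto simp: test_functions_iff)
  have "bounded ((deriv ^^ k) F ` {-B..B})"
    by (intro compact_imp_bounded compact_continuous_image smooth_continuous_on smooth_higher_deriv F) auto
  then obtain C where C: "\<And>x. x \<in> {-B..B} \<Longrightarrow> \<bar>(deriv ^^ k) F x\<bar> \<le> C"
    unfolding bounded_iff by (metis imageI real_norm_def)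
  have "\<bar>(deriv ^^ k) F x\<bar> \<le> max C 0" for x
    using C[of x] higher_deriv_eq_0_outside[of B F x k, OF F(2)] by (cases "\<bar>x\<bar> > B") fastforce+
  then show ?thesis by (rule that)
qed

text \<open>
  If \<open>P\<close> is any primitive of \<open>F\<close>, then \<open>G(x) = P(x) - P(x - h)\<close> is the integral of \<open>F\<close> over
  \<open>[x - h, x]\<close>. It has compact support although \<open>P\<close> in general has not, because \<open>P\<close> is
  constant on each side of the support of \<open>F\<close>.
\<close>

lemma test_function_difference_primitive:
  assumes F: "F \<in> test_functions" and h: "h \<ge> 0"
  obtains G where "G \<in> test_functions" "deriv G = (\<lambda>x. F x - F (x - h))"
proof -
  obtain B where sF: "smooth F" and B: "\<And>x. \<bar>x\<bar> > B \<Longrightarrow> F x = 0"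
    using F by (auto simp: test_functions_iff)
  obtain P where P: "\<And>x. (P has_real_derivative F x) (at x)"
    using einterval_antiderivative[of "-\<infinity>" "\<infinity>" F] smooth_continuous_on[OF sF, of UNIV]
    by (auto simp: continuous_on_eq_continuous_at has_real_derivative_iff_has_vector_derivative)
  define G where "G = (\<lambda>x. P x - P (x - h))"
  have G: "(G has_real_derivative F x - F (x - h)) (at x)" for x
    unfolding G_def by (intro DERIV_diff DERIV_shift_diff P)
  have const: "P x = P y" if "convex S" "\<And>z. z \<in> S \<Longrightarrow> \<bar>z\<bar> > B" "x \<in> S" "y \<in> S" for S x y
  proof -
    have "(P has_field_derivative 0) (at z within S)" if "z \<in> S" for z
      using P[of z] B[of z] that \<open>\<And>z. z \<in> S \<Longrightarrow> \<bar>z\<bar> > B\<close>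
      by (auto intro: has_field_derivative_at_within)
    then obtain c where "\<And>z. z \<in> S \<Longrightarrow> P z = c"
      using has_field_derivative_zero_constant[OF \<open>convex S\<close>] by blast
    with that show ?thesis by simp
  qed
  have "G x = 0" if "\<bar>x\<bar> > max B 0 + h" for x
  proof (cases "x > 0")
    case True
    have "P x = P (x - h)"
      by (rule const[of "{max B 0<..}"]) (use True that h in auto)
    then show ?thesis by (simp add: G_def)
  next
    case False
    have "P x = P (x - h)"
      by (rule const[of "{..<- max B 0}"]) (use False that h in auto)
    then show ?thesis by (simp add: G_def)
  qed
  moreover have "smooth G"
    by (rule smooth_antiderivative[OF smooth_diff_shift[OF sF, of h] G])
  ultimately have "G \<in> test_functions" by (auto simp: test_functions_iff)
  moreover have "deriv G = (\<lambda>x. F x - F (x - h))"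
    using G by (intro ext DERIV_imp_deriv)
  ultimately show ?thesis by (rule that)
qed

section \<open>Integration against the Gamma distribution\<close>

lemma gamma_density_nonneg: "\<kappa> > 0 \<Longrightarrow> gamma_density \<kappa> x \<ge> 0"
  by (simp add: gamma_density_def)

lemma gamma_density_measurable [measurable]: "gamma_density \<kappa> \<in> borel_measurable borel"
  unfolding gamma_density_def[abs_def] by measurable

lemma sets_gamma_distribution [simp, measurable_cong]: "sets (gamma_distribution \<kappa>) = sets borel"
  by (simp add: gamma_distribution_def)

lemma nn_integral_gamma_density:
  assumes "\<kappa> > 0"
  shows "(\<integral>\<^sup>+x. ennreal (gamma_density \<kappa> x) \<partial>lborel) = 1"
proof -
  have G: "Gamma \<kappa> > 0" using assms by simp
  have "((\<lambda>t. 1 / Gamma \<kappa> * (t powr (\<kappa> - 1) / exp t)) has_integral 1 / Gamma \<kappa> * Gamma \<kappa>) {0..}"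
    by (intro has_integral_mult_right Gamma_integral_real assms)
  then have "((\<lambda>t. t powr (\<kappa> - 1) * exp (- t) / Gamma \<kappa>) has_integral 1) {0..}"
    using G by (simp add: exp_minus field_simps)
  then have "(\<integral>\<^sup>+x. ennreal (x powr (\<kappa> - 1) * exp (- x) / Gamma \<kappa>) * indicator {0..} x \<partial>lborel) = ennreal 1"
    using G by (intro nn_integral_has_integral_lebesgue') auto
  moreover have "ennreal (gamma_density \<kappa> x) =
      ennreal (x powr (\<kappa> - 1) * exp (- x) / Gamma \<kappa>) * indicator {0..} x" for x
    by (auto simp: gamma_density_def indicator_def)
  ultimately show ?thesis by simp
qed

lemma prob_space_gamma_distribution: "\<kappa> > 0 \<Longrightarrow> prob_space (gamma_distribution \<kappa>)"
  by (intro prob_spaceI) (simp add: gamma_distribution_def emeasure_density nn_integral_gamma_density)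

lemma AE_gamma_distribution_pos: "AE x in gamma_distribution \<kappa>. x > 0"
  unfolding gamma_distribution_def by (subst AE_density) (auto simp: gamma_density_def)

lemma integral_gamma_distribution:
  assumes "\<kappa> > 0" "h \<in> borel_measurable borel"
  shows "(\<integral>x. h x \<partial>gamma_distribution \<kappa>) = (\<integral>x. gamma_density \<kappa> x * h x \<partial>lborel)"
  using assms unfolding gamma_distribution_def
  by (subst integral_density) (auto simp: gamma_density_nonneg)

lemma integrable_gamma_distribution_iff:
  assumes "\<kappa> > 0" "h \<in> borel_measurable borel"
  shows "integrable (gamma_distribution \<kappa>) h \<longleftrightarrow> integrable lborel (\<lambda>x. gamma_density \<kappa> x * h x)"
  using assms unfolding gamma_distribution_def
  by (subst integrable_density) (auto simp: gamma_density_nonneg)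

text \<open>
  Size biasing raises the parameter of a Gamma distribution by one. This accounts for the change
  of distribution in each step of the main induction.
\<close>

lemma gamma_density_shift:
  assumes "\<kappa> > 0"
  shows "gamma_density \<kappa> x * x = \<kappa> * gamma_density (\<kappa> + 1) x"
proof -
  have "Gamma (\<kappa> + 1) = \<kappa> * Gamma \<kappa>" "Gamma \<kappa> > 0"
    using assms by (auto simp: Gamma_plus1 nonpos_Ints_def)
  then show ?thesis
    using assms by (auto simp: gamma_density_def powr_diff)
qed

lemma integral_gamma_distribution_shift:
  assumes "\<kappa> > 0" "h \<in> borel_measurable borel"
  shows "(\<integral>x. x * h x \<partial>gamma_distribution \<kappa>) = \<kappa> * (\<integral>x. h x \<partial>gamma_distribution (\<kappa> + 1))"
proof -
  have "gamma_density \<kappa> x * (x * h x) = \<kappa> * (gamma_density (\<kappa> + 1) x * h x)" for x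
    using gamma_density_shift[OF assms(1), of x] by (simp add: mult.assoc[symmetric])
  then have "(\<integral>x. gamma_density \<kappa> x * (x * h x) \<partial>lborel) =
      \<kappa> * (\<integral>x. gamma_density (\<kappa> + 1) x * h x \<partial>lborel)"
    by (simp only: integral_mult_right_zero)
  with assms show ?thesis by (simp add: integral_gamma_distribution)
qed

lemma integrable_power_gamma_distribution:
  "\<kappa> > 0 \<Longrightarrow> integrable (gamma_distribution \<kappa>) (\<lambda>x. x ^ n)"
proof (induction n arbitrary: \<kappa>)
  case 0
  then interpret prob_space "gamma_distribution \<kappa>" by (rule prob_space_gamma_distribution)
  show ?case by simp
next
  case (Suc n)
  have "integrable lborel (\<lambda>x. \<kappa> * (gamma_density (\<kappa> + 1) x * x ^ n))"
    using Suc.IH[of "\<kappa> + 1"] Suc.prems by (simp add: integrable_gamma_distribution_iff)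
  also have "(\<lambda>x. \<kappa> * (gamma_density (\<kappa> + 1) x * x ^ n)) = (\<lambda>x. gamma_density \<kappa> x * x ^ Suc n)"
    using gamma_density_shift[OF Suc.prems] by (simp add: fun_eq_iff mult.assoc[symmetric])
  finally show ?case
    using Suc.prems by (subst integrable_gamma_distribution_iff) auto
qed

text \<open>
  Only the half-line carrying the Gamma distributions matters. Asking for a dominating polynomial,
  and not for a power of \<open>x\<close>, makes closure under sums and products immediate.
\<close>

definition poly_growth :: "(real \<Rightarrow> real) \<Rightarrow> bool" where
  "poly_growth h \<longleftrightarrow> (\<exists>p. \<forall>x>0. \<bar>h x\<bar> \<le> poly p x)"

lemma poly_growth_add: "poly_growth f \<Longrightarrow> poly_growth g \<Longrightarrow> poly_growth (\<lambda>x. f x + g x)"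
proof -
  assume "poly_growth f" "poly_growth g"
  then obtain p q where pq: "\<forall>x>0. \<bar>f x\<bar> \<le> poly p x" "\<forall>x>0. \<bar>g x\<bar> \<le> poly q x"
    unfolding poly_growth_def by blast
  have "\<bar>f x + g x\<bar> \<le> poly (p + q) x" if "x > 0" for x
    using abs_triangle_ineq[of "f x" "g x"] pq that by fastforce
  then show ?thesis unfolding poly_growth_def by blast
qed

lemma poly_growth_mult: "poly_growth f \<Longrightarrow> poly_growth g \<Longrightarrow> poly_growth (\<lambda>x. f x * g x)"
proof -
  assume "poly_growth f" "poly_growth g"
  then obtain p q where pq: "\<forall>x>0. \<bar>f x\<bar> \<le> poly p x" "\<forall>x>0. \<bar>g x\<bar> \<le> poly q x"
    unfolding poly_growth_def by blast
  have "\<bar>f x * g x\<bar> \<le> poly (p * q) x" if "x > 0" for x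
    unfolding abs_mult poly_mult using pq that
    by (intro mult_mono) (auto intro: order_trans[OF abs_ge_zero])
  then show ?thesis unfolding poly_growth_def by blast
qed

lemma poly_growth_poly: "poly_growth (poly p)"
proof -
  have "\<bar>y\<bar> \<le> 1 + y * y" for y :: real
    using sum_squares_bound[of 1 y] sum_squares_bound[of 1 "- y"] by (simp add: power2_eq_square abs_if)
  then have "\<bar>poly p x\<bar> \<le> poly (1 + p * p) x" for x by simp
  then show ?thesis unfolding poly_growth_def by blast
qed

lemma integrable_poly_growth:
  assumes "\<kappa> > 0" "h \<in> borel_measurable borel" "poly_growth h"
  shows "integrable (gamma_distribution \<kappa>) h"
proof -
  obtain p where p: "\<And>x. x > 0 \<Longrightarrow> \<bar>h x\<bar> \<le> poly p x"
    using assms(3) unfolding poly_growth_def by blast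
  show ?thesis
  proof (rule Bochner_Integration.integrable_bound)
    show "integrable (gamma_distribution \<kappa>) (poly p)"
      using assms(1) unfolding poly_altdef[abs_def]
      by (intro Bochner_Integration.integrable_sum integrable_mult_right integrable_power_gamma_distribution)
    show "h \<in> borel_measurable (gamma_distribution \<kappa>)" using assms(2) by simp
    show "AE x in gamma_distribution \<kappa>. norm (h x) \<le> norm (poly p x)"
      using AE_gamma_distribution_pos[of \<kappa>] by eventually_elim (use p in fastforce)
  qed
qed

lemma poly_mult_powr_exp_at_top:
  "((\<lambda>x. poly p x * (x powr \<kappa> * exp (- x))) \<longlongrightarrow> 0) at_top" for p :: "real poly"
proof (induction p arbitrary: \<kappa>)
  case (pCons a p)
  have "((\<lambda>x. a * (x powr \<kappa> * exp (- x)) + poly p x * (x powr (\<kappa> + 1) * exp (- x))) \<longlongrightarrow> a * 0 + 0) at_top"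
    by (intro tendsto_add tendsto_mult_left pCons.IH) real_asymp
  then have "((\<lambda>x. a * (x powr \<kappa> * exp (- x)) + poly p x * (x powr (\<kappa> + 1) * exp (- x))) \<longlongrightarrow> 0) at_top"
    by simp
  then show ?case
    by (rule Lim_transform_eventually)
      (use eventually_gt_at_top[of 0] in eventually_elim, simp add: powr_add algebra_simps)
qed simp

text \<open>
  The integrand times the weight \<open>x powr (\<kappa> - 1) * exp (- x)\<close> is minus the derivative of
  \<open>x powr \<kappa> * exp (- x) * g x\<close>, which vanishes at both ends: at \<open>0\<close> since \<open>\<kappa> > 0\<close>, and at
  infinity by the growth condition. For constant \<open>g\<close> it is the mean of the Gamma distribution, and
  in general it is Stein's identity.
\<close>

lemma gamma_integration_by_parts:
  assumes \<kappa>: "\<kappa> > 0"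
    and g: "\<And>x. (g has_real_derivative g' x) (at x)" "continuous_on UNIV g'"
    and growth: "poly_growth g" "poly_growth g'"
  shows "(\<integral>x. (x - \<kappa>) * g x - x * g' x \<partial>gamma_distribution \<kappa>) = 0"
proof -
  define w where "w x = x powr \<kappa> * exp (- x)" for x :: real
  define h where "h x = (x - \<kappa>) * g x - x * g' x" for x
  define f where "f x = x powr (\<kappa> - 1) * exp (- x) * - h x" for x
  obtain p where p: "\<And>x. x > 0 \<Longrightarrow> \<bar>g x\<bar> \<le> poly p x"
    using growth(1) by (auto simp: poly_growth_def)
  have contg: "continuous_on UNIV g"
    using g(1) by (blast intro: DERIV_continuous_on has_field_derivative_at_within)
  have conth: "continuous_on UNIV h"
    unfolding h_def by (intro continuous_intros contg g(2))
  then have meas: "h \<in> borel_measurable borel"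
    by (rule borel_measurable_continuous_onI)
  have "poly_growth (\<lambda>x. poly [:- \<kappa>, 1:] x * g x + poly [:0, -1:] x * g' x)"
    by (intro poly_growth_add poly_growth_mult poly_growth_poly growth)
  then have "poly_growth h" by (simp add: h_def[abs_def] algebra_simps)
  then have int: "integrable lborel (\<lambda>x. gamma_density \<kappa> x * h x)"
    using integrable_poly_growth integrable_gamma_distribution_iff \<kappa> meas by blast
  \<comment> \<open>The normalising constant and the sign are carried along here, so that \<open>f\<close> is the derivative of \<open>w * g\<close> itself.\<close>
  have f_eq: "indicator {0<..} x *\<^sub>R f x = - Gamma \<kappa> * (gamma_density \<kappa> x * h x)" for x
    using Gamma_real_pos[OF \<kappa>, THEN less_imp_neq] by (auto simp: f_def gamma_density_def indicator_def)
  have w_0: "((\<lambda>x. w x * g x) \<longlongrightarrow> 0) (at_right 0)"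
  proof -
    have "(w \<longlongrightarrow> 0) (at_right 0)" unfolding w_def using \<kappa> by real_asymp
    moreover have "(g \<longlongrightarrow> g 0) (at_right 0)"
      using contg
      by (metis UNIV_I continuous_on_def tendsto_within_subset subset_UNIV)
    ultimately have "((\<lambda>x. w x * g x) \<longlongrightarrow> 0 * g 0) (at_right 0)" by (rule tendsto_mult)
    then show ?thesis by simp
  qed
  have w_top: "((\<lambda>x. w x * g x) \<longlongrightarrow> 0) at_top"
  proof (rule Lim_null_comparison)
    show "((\<lambda>x. poly p x * w x) \<longlongrightarrow> 0) at_top"
      unfolding w_def by (rule poly_mult_powr_exp_at_top)
    show "\<forall>\<^sub>F x in at_top. norm (w x * g x) \<le> poly p x * w x"
      using eventually_gt_at_top[of 0]
      by eventually_elim (simp add: w_def abs_mult p mult.commute mult_left_mono)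
  qed
  have "(LBINT x=0..\<infinity>. f x) = 0 - 0"
  proof (rule interval_integral_FTC_integrable)
    fix x assume "0 < ereal x"
    then have x: "x > 0" by simp
    have "((\<lambda>x. w x * g x) has_real_derivative
        (\<kappa> * x powr (\<kappa> - 1) * exp (- x) + x powr \<kappa> * - exp (- x)) * g x + g' x * w x) (at x)"
      unfolding w_def using x g(1) by (auto intro!: derivative_eq_intros)
    also have "(\<kappa> * x powr (\<kappa> - 1) * exp (- x) + x powr \<kappa> * - exp (- x)) * g x + g' x * w x = f x"
      using x by (simp add: f_def h_def w_def powr_diff field_simps)
    finally show "((\<lambda>x. w x * g x) has_vector_derivative f x) (at x)"
      by (simp add: has_real_derivative_iff_has_vector_derivative)
    have "isCont h x" using conth by (simp add: continuous_on_eq_continuous_at)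
    then show "isCont f x"
      unfolding f_def using x by (intro continuous_intros) auto
  next
    show "set_integrable lborel (einterval 0 \<infinity>) f"
      unfolding set_integrable_def zero_ereal_def einterval_eq f_eq
      by (rule integrable_mult_right[OF int])
    show "(((\<lambda>x. w x * g x) \<circ> real_of_ereal) \<longlongrightarrow> 0) (at_right 0)"
      using w_0 unfolding zero_ereal_def ereal_tendsto_simps .
    show "(((\<lambda>x. w x * g x) \<circ> real_of_ereal) \<longlongrightarrow> 0) (at_left \<infinity>)"
      using w_top unfolding ereal_tendsto_simps .
  qed simp
  then have "(\<integral>x. - Gamma \<kappa> * (gamma_density \<kappa> x * h x) \<partial>lborel) = 0"
    unfolding interval_lebesgue_integral_0_infty set_lebesgue_integral_def f_eq by simp
  then have "(\<integral>x. gamma_density \<kappa> x * h x \<partial>lborel) = 0"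
    using Gamma_real_pos[OF \<kappa>] by simp
  then show ?thesis
    using integral_gamma_distribution[OF \<kappa> meas] by (simp add: h_def)
qed

text \<open>
  Integration by parts for \<open>g = P F\<close>, with \<open>P\<close> the Laguerre polynomial of degree \<open>m\<close> and
  parameter \<open>\<lambda> + 1\<close>, turns \<open>(x - \<lambda>) P F - x P' F\<close>, the next Laguerre polynomial times \<open>F\<close>, into
  \<open>x P F'\<close>; the factor \<open>x\<close> moves the integral to the parameter \<open>\<lambda> + 1\<close>, where the induction
  hypothesis applies to \<open>F'\<close>. Test functions would be too small a class here: the biasing constant
  is the case \<open>F x = x ^ m\<close>.
\<close>

lemma laguerre_poly_duality:
  assumes "lam > 0" "smooth F" "\<And>k. poly_growth ((deriv ^^ k) F)"
  shows "(\<integral>x. poly (laguerre_poly lam m) x * F x \<partial>gamma_distribution lam) =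
    (\<Prod>i<m. lam + real i) * (\<integral>x. (deriv ^^ m) F x \<partial>gamma_distribution (lam + real m))"
  using assms
proof (induction m arbitrary: lam F)
  case (Suc m)
  define P where "P = laguerre_poly (lam + 1) m"
  have lam: "lam > 0" and F: "smooth F" by fact+
  have growth: "poly_growth F" "poly_growth (deriv F)"
    using Suc.prems(3)[of 0] Suc.prems(3)[of 1] by auto
  have meas [measurable]: "F \<in> borel_measurable borel" "deriv F \<in> borel_measurable borel"
    "poly P \<in> borel_measurable borel" "poly (pderiv P) \<in> borel_measurable borel"
    by (auto intro: smooth_measurable smooth_deriv F smooth_poly)
  let ?g = "\<lambda>x. poly P x * F x" and ?g' = "\<lambda>x. poly (pderiv P) x * F x + poly P x * deriv F x"
  have parts: "(\<integral>x. (x - lam) * ?g x - x * ?g' x \<partial>gamma_distribution lam) = 0"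
  proof (rule gamma_integration_by_parts[OF lam])
    show "(?g has_real_derivative ?g' x) (at x)" for x
      using smooth_has_derivative[OF F, of x]
      by (auto intro!: derivative_eq_intros poly_DERIV)
    show "continuous_on UNIV ?g'"
      by (intro continuous_intros smooth_continuous_on smooth_deriv F)
    show "poly_growth ?g" "poly_growth ?g'"
      by (intro poly_growth_add poly_growth_mult poly_growth_poly growth)+
  qed
  have "integrable (gamma_distribution lam) (\<lambda>x. poly [:0, 1:] x * (poly P x * deriv F x))"
    by (rule integrable_poly_growth[OF lam])
      (intro smooth_measurable smooth_mult smooth_poly smooth_deriv F poly_growth_mult
        poly_growth_poly growth)+
  then have int1: "integrable (gamma_distribution lam) (\<lambda>x. x * (poly P x * deriv F x))" by simp
  have int2: "integrable (gamma_distribution lam) (\<lambda>x. poly (laguerre_poly lam (Suc m)) x * F x)"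
    by (rule integrable_poly_growth[OF lam])
      (auto intro!: poly_growth_mult poly_growth_poly growth smooth_measurable smooth_mult smooth_poly F)
  have split: "poly (laguerre_poly lam (Suc m)) x * F x - x * (poly P x * deriv F x) =
      (x - lam) * ?g x - x * ?g' x" for x
    by (simp add: P_def Let_def algebra_simps)
  have "(\<integral>x. poly (laguerre_poly lam (Suc m)) x * F x \<partial>gamma_distribution lam) =
      (\<integral>x. x * (poly P x * deriv F x) \<partial>gamma_distribution lam)"
    using Bochner_Integration.integral_diff[OF int2 int1] parts by (simp only: split)
  also have "\<dots> = lam * (\<integral>x. poly P x * deriv F x \<partial>gamma_distribution (lam + 1))"
    by (rule integral_gamma_distribution_shift[OF lam]) measurable
  also have "(\<integral>x. poly P x * deriv F x \<partial>gamma_distribution (lam + 1)) =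
      (\<Prod>i<m. lam + 1 + real i) *
        (\<integral>x. (deriv ^^ m) (deriv F) x \<partial>gamma_distribution (lam + 1 + real m))"
    unfolding P_def
  proof (rule Suc.IH)
    show "poly_growth ((deriv ^^ k) (deriv F))" for k
      using Suc.prems(3)[of "Suc k"] by (simp add: funpow_swap1)
  qed (use lam F in \<open>auto intro: smooth_deriv\<close>)
  also have "lam * ((\<Prod>i<m. lam + 1 + real i) * I) = (\<Prod>i<Suc m. lam + real i) * I" for I
    by (simp add: prod.lessThan_Suc_shift algebra_simps del: prod.lessThan_Suc)
  finally show ?case
    by (simp only: funpow_Suc_right o_def of_nat_Suc ac_simps)
qed simp

lemma test_function_duality:
  assumes "lam > 0" "F \<in> test_functions"
  shows "(\<integral>x. laguerre lam m x * F x \<partial>gamma_distribution lam) =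
    (\<Prod>i<m. lam + real i) * (\<integral>x. (deriv ^^ m) F x \<partial>gamma_distribution (lam + real m))"
  unfolding laguerre_eq_poly
proof (rule laguerre_poly_duality)
  show "smooth F" using assms by (simp add: test_functions_iff)
  show "poly_growth ((deriv ^^ k) F)" for k
  proof -
    obtain C where "\<And>x. \<bar>(deriv ^^ k) F x\<bar> \<le> C"
      using test_function_higher_deriv_bounded[OF assms(2)] by blast
    then show ?thesis unfolding poly_growth_def by (intro exI[of _ "[:C:]"]) simp
  qed
qed fact

lemma laguerre_biasing_constant:
  assumes "lam > 0"
  shows "1 / fact m * (\<integral>x. x ^ m * laguerre lam m x \<partial>gamma_distribution lam) = (\<Prod>i<m. lam + real i)"
proof -
  interpret prob_space "gamma_distribution (lam + real m)"
    using assms by (intro prob_space_gamma_distribution) simp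
  have power: "(\<lambda>x::real. x ^ m) = poly (monom 1 m)" for m :: nat
    by (simp add: poly_monom fun_eq_iff)
  have "(\<integral>x. poly (laguerre_poly lam m) x * x ^ m \<partial>gamma_distribution lam) =
    (\<Prod>i<m. lam + real i) * (\<integral>x. (deriv ^^ m) (\<lambda>x. x ^ m) x \<partial>gamma_distribution (lam + real m))"
    by (rule laguerre_poly_duality[OF assms])
      (auto simp: power higher_deriv_poly intro: smooth_poly poly_growth_poly)
  then show ?thesis
    using prob_space by (simp add: higher_deriv_power laguerre_eq_poly mult.commute)
qed

section \<open>Test functions determine a probability measure\<close>

text \<open>
  The polynomial factor in \<open>1 / x\<close> makes the family closed under differentiation; the member used
  for the construction of test functions is the one with \<open>p = 1\<close>.
\<close>

definition flat_exp :: "real poly \<Rightarrow> real \<Rightarrow> real" where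
  "flat_exp p x = (if x > 0 then poly p (1 / x) * exp (- 1 / x) else 0)"

text \<open>
  At \<open>0\<close> the difference quotient is again a polynomial in \<open>1 / x\<close> times \<open>exp (- 1 / x)\<close>, and it
  tends to \<open>0\<close> since \<open>exp (- y)\<close> beats every polynomial at infinity.
\<close>

lemma flat_exp_DERIV:
  "(flat_exp p has_real_derivative flat_exp ([:0, 0, 1:] * (p - pderiv p)) x) (at x)"
proof -
  have lim: "((\<lambda>t. poly q (1 / t) * exp (- 1 / t)) \<longlongrightarrow> 0) (at_right 0)" for q :: "real poly"
  proof -
    have "((\<lambda>x. poly q x * (x powr 0 * exp (- x))) \<longlongrightarrow> 0) at_top"
      by (rule poly_mult_powr_exp_at_top)
    then have "((\<lambda>x. poly q x * exp (- x)) \<longlongrightarrow> 0) at_top"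
      by (rule Lim_transform_eventually)
        (use eventually_gt_at_top[of 0] in eventually_elim, simp)
    from filterlim_compose[OF this filterlim_inverse_at_top_right] show ?thesis
      by (simp add: divide_inverse)
  qed
  consider "x > 0" | "x < 0" | "x = 0" by linarith
  then show ?thesis
  proof cases
    case 1
    have "((\<lambda>x. poly p (1 / x) * exp (- 1 / x)) has_real_derivative
        (- 1 / x\<^sup>2) * poly (pderiv p) (1 / x) * exp (- 1 / x) + exp (- 1 / x) * (1 / x\<^sup>2) * poly p (1 / x)) (at x)"
      using 1 by (auto intro!: derivative_eq_intros DERIV_chain2[OF poly_DERIV] simp: power2_eq_square)
    then have "((\<lambda>x. poly p (1 / x) * exp (- 1 / x)) has_real_derivative
        flat_exp ([:0, 0, 1:] * (p - pderiv p)) x) (at x)"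
      using 1 by (simp add: flat_exp_def power2_eq_square algebra_simps diff_divide_distrib)
    then show ?thesis
      by (rule has_field_derivative_transform_within_open[where S = "{0<..}"])
        (use 1 in \<open>auto simp: flat_exp_def\<close>)
  next
    case 2
    have "((\<lambda>x. 0) has_real_derivative 0) (at x)" by simp
    then have "(flat_exp p has_real_derivative 0) (at x)"
      by (rule has_field_derivative_transform_within_open[where S = "{..<0}"])
        (use 2 in \<open>auto simp: flat_exp_def\<close>)
    then show ?thesis using 2 by (simp add: flat_exp_def)
  next
    case 3
    have "((\<lambda>t. flat_exp p t / t) \<longlongrightarrow> 0) (at 0)"
    proof (rule filterlim_split_at)
      show "((\<lambda>t. flat_exp p t / t) \<longlongrightarrow> 0) (at_left 0)"
        by (rule Lim_transform_eventually[OF tendsto_const])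
          (auto simp: flat_exp_def eventually_at_filter)
      show "((\<lambda>t. flat_exp p t / t) \<longlongrightarrow> 0) (at_right 0)"
        by (rule Lim_transform_eventually[OF lim[of "[:0, 1:] * p"]])
          (auto simp: flat_exp_def eventually_at_filter)
    qed
    then show ?thesis
      using 3 by (simp add: has_field_derivative_iff flat_exp_def)
  qed
qed

lemma smooth_flat_exp_affine: "smooth (\<lambda>x. flat_exp p (c * x + d))"
proof (rule smooth_coinduct[where S = "range (\<lambda>p x. flat_exp p (c * x + d))"])
  fix f assume "f \<in> range (\<lambda>p x. flat_exp p (c * x + d))"
  then obtain p where f: "f = (\<lambda>x. flat_exp p (c * x + d))" by blast
  define q where "q = smult c ([:0, 0, 1:] * (p - pderiv p))"
  have "((\<lambda>x. c * x + d) has_real_derivative c) (at x)" for x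
    by (auto intro!: derivative_eq_intros)
  from DERIV_chain2[OF flat_exp_DERIV this]
  have "(f has_real_derivative flat_exp ([:0, 0, 1:] * (p - pderiv p)) (c * x + d) * c) (at x)" for x
    unfolding f .
  moreover have "flat_exp ([:0, 0, 1:] * (p - pderiv p)) y * c = flat_exp q y" for y
    by (simp add: q_def flat_exp_def)
  ultimately have "(f has_real_derivative flat_exp q (c * x + d)) (at x)" for x
    by simp
  then show "\<exists>f'\<in>range (\<lambda>p x. flat_exp p (c * x + d)). \<forall>x. (f has_real_derivative f' x) (at x)"
    by (intro bexI[of _ "\<lambda>x. flat_exp q (c * x + d)"]) auto
qed blast

text \<open>
  Open half-lines determine a probability measure. With \<open>\<phi>(x) = exp (- 1 / x)\<close> for \<open>x > 0\<close> and
  \<open>\<phi>(x) = 0\<close> otherwise, the test functions \<open>\<phi>(n (x - a)) * \<phi>(n - x)\<close> are bounded by \<open>1\<close> and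
  converge to the indicator of \<open>{a<..}\<close>: the first factor tends to the indicator, the second one
  cuts off at \<open>n\<close> and tends to \<open>1\<close>.
\<close>

lemma measure_eqI_test_functions:
  fixes \<mu> \<nu> :: "real measure"
  assumes \<mu>: "prob_space \<mu>" "sets \<mu> = sets borel" and \<nu>: "prob_space \<nu>" "sets \<nu> = sets borel"
    and eq: "\<And>F. F \<in> test_functions \<Longrightarrow> (\<integral>x. F x \<partial>\<mu>) = (\<integral>x. F x \<partial>\<nu>)"
  shows "\<mu> = \<nu>"
proof (rule measure_eqI_lessThan)
  interpret \<mu>: prob_space \<mu> by fact
  interpret \<nu>: prob_space \<nu> by fact
  show "emeasure \<mu> {a<..} < \<infinity>" for a by (simp add: less_top[symmetric])
  show "emeasure \<mu> {a<..} = emeasure \<nu> {a<..}" for a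
  proof -
    define F where "F n x = flat_exp 1 (real n * x + - real n * a) * flat_exp 1 (- 1 * x + real n)" for n x
    have smooth: "smooth (F n)" for n
      unfolding F_def by (intro smooth_mult smooth_flat_exp_affine)
    have range: "\<bar>flat_exp 1 x\<bar> \<le> 1" for x
      by (simp add: flat_exp_def)
    have bound: "\<bar>F n x\<bar> \<le> 1" for n x
      unfolding F_def abs_mult by (intro mult_le_one range) simp
    have "F n x = 0" if "\<bar>x\<bar> > max \<bar>a\<bar> (real n)" for n x
    proof (cases "x > 0")
      case False
      with that have "x < a" by linarith
      then have "real n * x \<le> real n * a" by (intro mult_left_mono) auto
      then show ?thesis by (simp add: F_def flat_exp_def)
    qed (use that in \<open>simp add: F_def flat_exp_def\<close>)
    with smooth have test: "F n \<in> test_functions" for n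
      unfolding test_functions_iff by blast
    have lim: "(\<lambda>n. F n x) \<longlonglongrightarrow> indicator {a<..} x" for x
    proof (cases "x > a")
      case True
      define c where "c = x - a"
      have c: "c > 0" using True by (simp add: c_def)
      have "(\<lambda>n. exp (- 1 / (real n * c)) * exp (- 1 / (real n - x))) \<longlonglongrightarrow> 1"
        using c by real_asymp
      moreover have "\<forall>\<^sub>F n in sequentially. exp (- 1 / (real n * c)) * exp (- 1 / (real n - x)) = F n x"
        using eventually_gt_at_top[of "nat \<lceil>\<bar>x\<bar>\<rceil>"]
      proof eventually_elim
        case (elim n)
        then have "real n > x" "real n > 0" by linarith+
        then show ?case using c
          by (simp add: F_def flat_exp_def c_def algebra_simps)
      qed
      ultimately have "(\<lambda>n. F n x) \<longlonglongrightarrow> 1" by (rule Lim_transform_eventually)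
      with True show ?thesis by simp
    next
      case False
      then have "real n * x \<le> real n * a" for n by (intro mult_left_mono) auto
      then have "flat_exp 1 (real n * x + - real n * a) = 0" for n
        by (simp add: flat_exp_def not_less)
      then have "F n x = 0" for n by (simp add: F_def)
      with False show ?thesis by simp
    qed
    have conv: "(\<lambda>n. \<integral>x. F n x \<partial>\<rho>) \<longlonglongrightarrow> measure \<rho> {a<..}"
      if "prob_space \<rho>" and [measurable_cong]: "sets \<rho> = sets borel" for \<rho> :: "real measure"
    proof -
      interpret \<rho>: prob_space \<rho> by fact
      have [measurable]: "F n \<in> borel_measurable borel" for n
        by (rule smooth_measurable[OF smooth])
      have "(\<lambda>n. \<integral>x. F n x \<partial>\<rho>) \<longlonglongrightarrow> (\<integral>x. indicator {a<..} x \<partial>\<rho>)"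
        by (rule integral_dominated_convergence[where w = "\<lambda>_. 1"]) (auto simp: lim bound)
      then show ?thesis
        using sets_eq_imp_space_eq[OF that(2)] by simp
    qed
    have "measure \<mu> {a<..} = measure \<nu> {a<..}"
      using LIMSEQ_unique[OF conv[OF \<mu>]] conv[OF \<nu>] eq[OF test] by simp
    then show ?thesis by (simp add: \<mu>.emeasure_eq_measure \<nu>.emeasure_eq_measure)
  qed
qed fact+

lemma integral_shift_tendsto_0:
  assumes "prob_space \<rho>" and [measurable_cong]: "sets \<rho> = sets borel"
    and [measurable]: "G \<in> borel_measurable borel"
    and bound: "\<And>x. \<bar>G x\<bar> \<le> C" and vanish: "\<And>x::real. \<bar>x\<bar> > B \<Longrightarrow> G x = (0::real)"
  shows "(\<lambda>n. \<integral>x. G (x - real n) \<partial>\<rho>) \<longlonglongrightarrow> 0"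
proof -
  interpret prob_space \<rho> by fact
  have "(\<lambda>n. \<integral>x. G (x - real n) \<partial>\<rho>) \<longlonglongrightarrow> (\<integral>x. 0 \<partial>\<rho>)"
  proof (rule integral_dominated_convergence[where w = "\<lambda>_. C"])
    show "AE x in \<rho>. (\<lambda>n. G (x - real n)) \<longlonglongrightarrow> 0"
    proof (rule AE_I2)
      fix x
      have "\<forall>\<^sub>F n in sequentially. 0 = G (x - real n)"
        using eventually_gt_at_top[of "nat \<lceil>\<bar>x\<bar> + \<bar>B\<bar>\<rceil>"]
      proof eventually_elim
        case (elim n)
        then have "real n > \<bar>x\<bar> + \<bar>B\<bar>" by linarith
        then show ?case by (intro vanish[symmetric]) linarith
      qed
      then show "(\<lambda>n. G (x - real n)) \<longlonglongrightarrow> 0"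
        by (rule Lim_transform_eventually[OF tendsto_const])
    qed
  qed (auto simp: bound)
  then show ?thesis by simp
qed

text \<open>
  For a test function \<open>F\<close> and \<open>G = F\<^sup>(\<^sup>m\<^sup>)\<close>, the function \<open>G(x) - G(x - n)\<close> is an \<open>(m + 1)\<close>-st
  derivative of a test function, so both measures give it the same integral. Letting \<open>n\<close> tend to
  infinity removes the shifted term, and the integrals of \<open>G\<close> itself agree.
\<close>

lemma measure_eqI_higher_deriv_test_functions:
  fixes \<mu> \<nu> :: "real measure"
  assumes \<mu>: "prob_space \<mu>" "sets \<mu> = sets borel" and \<nu>: "prob_space \<nu>" "sets \<nu> = sets borel"
    and eq: "\<And>F. F \<in> test_functions \<Longrightarrow> (\<integral>x. (deriv ^^ m) F x \<partial>\<mu>) = (\<integral>x. (deriv ^^ m) F x \<partial>\<nu>)"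
  shows "\<mu> = \<nu>"
  using eq
proof (induction m)
  case 0
  then show ?case using measure_eqI_test_functions[OF \<mu> \<nu>] by simp
next
  case (Suc m)
  show ?case
  proof (rule Suc.IH)
    fix F assume F: "F \<in> test_functions"
    define G where "G = (deriv ^^ m) F"
    obtain B where sF: "smooth F" and B: "\<And>x. \<bar>x\<bar> > B \<Longrightarrow> F x = 0"
      using F by (auto simp: test_functions_iff)
    obtain C where C: "\<And>x. \<bar>G x\<bar> \<le> C"
      using test_function_higher_deriv_bounded[OF F] unfolding G_def by blast
    have vanish: "G x = 0" if "\<bar>x\<bar> > B" for x
      unfolding G_def using B that by (rule higher_deriv_eq_0_outside)
    have [measurable]: "G \<in> borel_measurable borel"
      unfolding G_def by (intro smooth_measurable smooth_higher_deriv sF)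
    have diff: "(\<integral>x. G x - G (x - real n) \<partial>\<rho>) = (\<integral>x. G x \<partial>\<rho>) - (\<integral>x. G (x - real n) \<partial>\<rho>)"
      if "prob_space \<rho>" and [measurable_cong]: "sets \<rho> = sets borel" for \<rho> :: "real measure" and n
    proof -
      interpret prob_space \<rho> by fact
      show ?thesis
        by (intro Bochner_Integration.integral_diff integrable_const_bound[where B = C])
          (auto simp: C)
    qed
    have "(\<integral>x. G x \<partial>\<mu>) - (\<integral>x. G (x - real n) \<partial>\<mu>) = (\<integral>x. G x \<partial>\<nu>) - (\<integral>x. G (x - real n) \<partial>\<nu>)" for n
    proof -
      obtain H where H: "H \<in> test_functions" "deriv H = (\<lambda>x. F x - F (x - real n))"
        using test_function_difference_primitive[OF F, of "real n"] by auto
      have "(deriv ^^ Suc m) H = (\<lambda>x. G x - G (x - real n))"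
        unfolding funpow_Suc_right o_def H(2) G_def by (rule higher_deriv_diff_shift[OF sF])
      with Suc.prems[OF H(1)] show ?thesis by (simp add: diff \<mu> \<nu>)
    qed
    then have "(\<lambda>n. (\<integral>x. G x \<partial>\<mu>) - (\<integral>x. G (x - real n) \<partial>\<mu>)) =
        (\<lambda>n. (\<integral>x. G x \<partial>\<nu>) - (\<integral>x. G (x - real n) \<partial>\<nu>))" by simp
    moreover have "(\<lambda>n. (\<integral>x. G x \<partial>\<rho>) - (\<integral>x. G (x - real n) \<partial>\<rho>)) \<longlonglongrightarrow> (\<integral>x. G x \<partial>\<rho>) - 0"
      if "prob_space \<rho>" "sets \<rho> = sets borel" for \<rho> :: "real measure"
      by (intro tendsto_diff tendsto_const integral_shift_tendsto_0[where B = B and C = C] that)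
        (auto simp: C vanish)
    ultimately have "(\<integral>x. G x \<partial>\<mu>) - 0 = (\<integral>x. G x \<partial>\<nu>) - 0"
      using \<mu> \<nu> by (metis LIMSEQ_unique)
    then show "(\<integral>x. (deriv ^^ m) F x \<partial>\<mu>) = (\<integral>x. (deriv ^^ m) F x \<partial>\<nu>)"
      by (simp add: G_def)
  qed
qed

section \<open>The Laguerre transform of the Gamma distribution\<close>

text \<open>
  The biasing constant is the positive product occurring in the duality for test functions, so
  it can be cancelled; what remains is that integrals of \<open>m\<close>-th derivatives determine the law.
\<close>

lemma laguerre_biased_gamma_iff:
  assumes lam: "lam > 0" and M: "prob_space M" and X [measurable]: "X \<in> borel_measurable M"
    and distr: "distr M borel X = gamma_distribution lam"
  shows "laguerre_biased lam m M X \<nu> \<longleftrightarrow> \<nu> = gamma_distribution (lam + real m)"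
proof -
  define \<alpha> where "\<alpha> = (\<Prod>i<m. lam + real i)"
  have \<alpha>: "\<alpha> > 0" unfolding \<alpha>_def using lam by (intro prod_pos) simp
  have transfer: "(\<integral>\<omega>. h (X \<omega>) \<partial>M) = (\<integral>x. h x \<partial>gamma_distribution lam)"
    if "h \<in> borel_measurable borel" for h :: "real \<Rightarrow> real"
    unfolding distr[symmetric] using that by (simp add: integral_distr)
  have meas: "laguerre lam m \<in> borel_measurable borel"
    unfolding laguerre_eq_poly[abs_def] by (intro smooth_measurable smooth_poly)
  have "integrable M (\<lambda>\<omega>. X \<omega> ^ k)" for k
    using integrable_power_gamma_distribution[OF lam, of k]
    unfolding distr[symmetric] by (subst (asm) integrable_distr_eq) auto
  then have moments: "moments_agree (2 * m) M X (gamma_distribution lam) (\<lambda>x. x)"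
    using integrable_power_gamma_distribution[OF lam]
    by (auto simp: moments_agree_def intro!: transfer)
  have const: "1 / fact m * (\<integral>\<omega>. X \<omega> ^ m * laguerre lam m (X \<omega>) \<partial>M) = \<alpha>"
    using laguerre_biasing_constant[OF lam, of m] transfer[of "\<lambda>x. x ^ m * laguerre lam m x"] meas
    by (simp add: \<alpha>_def)
  have lhs: "(\<integral>\<omega>. laguerre lam m (X \<omega>) * F (X \<omega>) \<partial>M) =
      \<alpha> * (\<integral>x. (deriv ^^ m) F x \<partial>gamma_distribution (lam + real m))"
    if F: "F \<in> test_functions" for F
  proof -
    have "F \<in> borel_measurable borel"
      using F by (auto simp: test_functions_iff intro: smooth_measurable)
    then show ?thesis
      using transfer[of "\<lambda>x. laguerre lam m x * F x"] test_function_duality[OF lam F, of m] meas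
      by (simp add: \<alpha>_def)
  qed
  have gamma: "prob_space (gamma_distribution (lam + real m))"
    using lam by (intro prob_space_gamma_distribution) simp
  have "laguerre_biased lam m M X \<nu> \<longleftrightarrow> prob_space \<nu> \<and> sets \<nu> = sets borel \<and>
      (\<forall>F\<in>test_functions. (\<integral>x. (deriv ^^ m) F x \<partial>gamma_distribution (lam + real m)) =
         (\<integral>x. (deriv ^^ m) F x \<partial>\<nu>))"
    unfolding laguerre_biased_def biased_distribution_def const
    using M moments \<alpha> by (auto simp: lhs)
  also have "\<dots> \<longleftrightarrow> \<nu> = gamma_distribution (lam + real m)"
    using measure_eqI_higher_deriv_test_functions[OF gamma _, of \<nu> m] gamma by auto
  finally show ?thesis .
qed

theorem mainTheorem7:
  fixes lam :: real and m :: nat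
    and M :: "real \<Rightarrow> 'a measure" and Z :: "real \<Rightarrow> 'a \<Rightarrow> real"
  assumes "lam > 0"
    and "\<And>\<kappa>. \<kappa> > 0 \<Longrightarrow> prob_space (M \<kappa>)"
    and "\<And>\<kappa>. \<kappa> > 0 \<Longrightarrow> distributed (M \<kappa>) lborel (Z \<kappa>) (\<lambda>x. ennreal (gamma_density \<kappa> x))"
  shows "(\<forall>F\<in>test_functions.
            (\<integral>\<omega>. laguerre lam m (Z lam \<omega>) * F (Z lam \<omega>) \<partial>M lam) =
            (\<Prod>i<m. lam + real i) *
              (\<integral>\<omega>. (deriv ^^ m) F (Z (lam + real m) \<omega>) \<partial>M (lam + real m)))
       \<and> (\<forall>\<nu>. laguerre_biased lam m (M lam) (Z lam) \<nu> \<longleftrightarrow>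
              \<nu> = distr (M (lam + real m)) borel (Z (lam + real m)))
       \<and> laguerre_transform lam m (gamma_distribution lam) = gamma_distribution (lam + real m)"
proof -
  have lamm: "lam + real m > 0" using assms(1) by simp
  have Z [measurable]: "Z \<kappa> \<in> borel_measurable (M \<kappa>)" if "\<kappa> > 0" for \<kappa>
    using distributed_measurable[OF assms(3)[OF that]] by simp
  have distr: "distr (M \<kappa>) borel (Z \<kappa>) = gamma_distribution \<kappa>" if "\<kappa> > 0" for \<kappa>
    using distributed_distr_eq_density[OF assms(3)[OF that]]
    by (simp add: gamma_distribution_def cong: distr_cong)
  have transfer: "(\<integral>\<omega>. h (Z \<kappa> \<omega>) \<partial>M \<kappa>) = (\<integral>x. h x \<partial>gamma_distribution \<kappa>)"
    if "\<kappa> > 0" "h \<in> borel_measurable borel" for h :: "real \<Rightarrow> real" and \<kappa>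
    unfolding distr[OF that(1), symmetric] using that Z by (simp add: integral_distr)
  have "(\<integral>\<omega>. laguerre lam m (Z lam \<omega>) * F (Z lam \<omega>) \<partial>M lam) =
      (\<Prod>i<m. lam + real i) *
        (\<integral>\<omega>. (deriv ^^ m) F (Z (lam + real m) \<omega>) \<partial>M (lam + real m))"
    if F: "F \<in> test_functions" for F
  proof -
    have "smooth F" using F by (simp add: test_functions_iff)
    then have "(\<lambda>x. laguerre lam m x * F x) \<in> borel_measurable borel"
      "(deriv ^^ m) F \<in> borel_measurable borel"
      unfolding laguerre_eq_poly
      by (intro smooth_measurable smooth_mult smooth_poly smooth_higher_deriv; assumption)+
    then show ?thesis
      using test_function_duality[OF assms(1) F, of m]
        transfer[OF assms(1), of "\<lambda>x. laguerre lam m x * F x"] transfer[OF lamm, of "(deriv ^^ m) F"]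
      by simp
  qed
  moreover have "laguerre_biased lam m (M lam) (Z lam) \<nu> \<longleftrightarrow>
      \<nu> = distr (M (lam + real m)) borel (Z (lam + real m))" for \<nu>
    unfolding distr[OF lamm] using assms Z distr by (intro laguerre_biased_gamma_iff) auto
  moreover have "laguerre_transform lam m (gamma_distribution lam) = gamma_distribution (lam + real m)"
  proof -
    have "laguerre_biased lam m (gamma_distribution lam) (\<lambda>x. x) \<nu> \<longleftrightarrow>
        \<nu> = gamma_distribution (lam + real m)" for \<nu>
      using assms(1) prob_space_gamma_distribution
      by (intro laguerre_biased_gamma_iff) (auto intro: distr_id2)
    then show ?thesis unfolding laguerre_transform_def by (intro the_equality) auto
  qed
  ultimately show ?thesis by blast
qed

end
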